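(* Let $s$ be a weak composition. The $f$-polynomial $\sum_{F\in\operatorname{Asso}(s)}t^{\dim(F)}$ of the $s$-associahedron $\operatorname{Asso}(s)$ is given by $$\sum_T(1+t)^{\operatorname{tasc}(T)},$$ where the sum ranges over all $s$-Tamari trees $T$ and $\operatorname{tasc}(T)$ denotes the number of Tamari-ascents of $T$.
   Context: A weak composition of length $n$ is a sequence $s=(s(1),\dots,s(n))$ of non-negative integers. An $s$-decreasing tree is a rooted planar tree with $n$ internal nodes labeled bijectively by $1,\dots,n$ (leaves are unlabeled) such that node $i$ has exactly $s(i)+1$ ordered children and labels decrease from root to leaves; $T^y_0,\dots,T^y_{s(y)}$ denote the child subtrees of $y$ from left to right. For nodes $a<c$, $\#_T(c,a)$ is $0$ if $a$ is left of $c$ or in $T^c_0$; $i$ if $a$ is in $T^c_i$ with $0<i<s(c)$; $s(c)$ if $a$ is in $T^c_{s(c)}$ or right of $c$. $\operatorname{inv}(T)$ is the multi-set in which $(c,a)$ occurs $\#_T(c,a)$ times; it determines $T$. The $s$-weak order is: $R\preccurlyeq T$ iff $\#_R(c,a)\le\#_T(c,a)$ for all $a<c$. An $s$-Tamari tree is an $s$-decreasing tree with $\#_T(c,a)\le\#_T(c,b)$ for all $a<b<c$. The $s$-Tamari lattice is the restriction of the $s$-weak order to $s$-Tamari trees. A Tamari-ascent of an $s$-Tamari tree $T$ is a pair $(a,c)$, $a<c$, such that $a$ is a non-right child of $c$, i.e. $a$ is the root of $T^c_i$ with $i<s(c)$. The transitive closure $I^{\mathsf{tc}}$ of a multi-set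 $I$ of pairs $(c,a)$, $a<c$, has $\#_{I^{\mathsf{tc}}}(c,a)$ equal to the maximum of $\#_I(b_1,b_2)$ over all lists $c=b_1>\dots>b_k=a$, $k\ge2$, with all $\#_I(b_i,b_{i+1})>0$ ($0$ if none). For a (possibly empty) set $A$ of Tamari-ascents of $T$, $T+A$ is the $s$-Tamari tree whose tree-inversion multi-set is obtained from $\operatorname{inv}(T)$ by increasing $\#_T(c,a)$ by one for each $(a,c)\in A$ and then taking the transitive closure. A pure $s$-Tamari interval is an interval of the $s$-Tamari lattice of the form $[T,T+A]$. The $s$-associahedron $\operatorname{Asso}(s)$ is the collection of all pure $s$-Tamari intervals (its faces); the dimension of $[T,T+A]$ is $|A|$. *)

theory Defs
  imports
    "HOL-Library.Multiset"
    "HOL-Computational_Algebra.Polynomial"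
begin

(* A weak composition of length n is a list of n natural numbers; list positions start at 0,
   whereas the entries of a weak composition are indexed by 1, ..., n. *)
type_synonym weak_comp = "nat list"

definition part :: "weak_comp \<Rightarrow> nat \<Rightarrow> nat" where
  "part s i = s ! (i - 1)"


section \<open>Decreasing trees\<close>

(* The list holds the children from left to right. *)
datatype tree = Leaf | Node nat "tree list"

primrec labels :: "tree \<Rightarrow> nat list" where
  "labels Leaf = []"
| "labels (Node y ts) = y # concat (map labels ts)"

primrec subtrees :: "tree \<Rightarrow> tree set" where
  "subtrees Leaf = {Leaf}"
| "subtrees (Node y ts) = insert (Node y ts) (\<Union> (set (map subtrees ts)))"

definition decreasing_tree :: "weak_comp \<Rightarrow> tree \<Rightarrow> bool" where
  "decreasing_tree s T \<longleftrightarrow>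
     distinct (labels T) \<and> set (labels T) = {1..length s} \<and>
     (\<forall>y ts. Node y ts \<in> subtrees T \<longrightarrow>
        length ts = part s y + 1 \<and> (\<forall>t\<in>set ts. \<forall>x\<in>set (labels t). x < y))"

(* For S = T^y_i, the i-th child subtree of y. It is a relation because y need not occur in T. *)
definition child_subtree :: "tree \<Rightarrow> nat \<Rightarrow> nat \<Rightarrow> tree \<Rightarrow> bool" where
  "child_subtree T y i S \<longleftrightarrow> (\<exists>ts. Node y ts \<in> subtrees T \<and> i < length ts \<and> S = ts ! i)"

definition in_child :: "tree \<Rightarrow> nat \<Rightarrow> nat \<Rightarrow> nat \<Rightarrow> bool" where
  "in_child T y i a \<longleftrightarrow> (\<exists>S. child_subtree T y i S \<and> a \<in> set (labels S))"

(* a is left of c if they lie in different child subtrees of some node, the one of a being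
   further to the left; in particular neither is then an ancestor of the other. *)
definition left_of :: "tree \<Rightarrow> nat \<Rightarrow> nat \<Rightarrow> bool" where
  "left_of T a c \<longleftrightarrow> (\<exists>y i j. i < j \<and> in_child T y i a \<and> in_child T y j c)"


section \<open>Tree-inversions and the weak order\<close>

(* Meant for nodes a < c. If s(c) = 0, the first two cases both apply to a descendant a of c
   and agree. *)
definition inv_num :: "weak_comp \<Rightarrow> tree \<Rightarrow> nat \<Rightarrow> nat \<Rightarrow> nat" where
  "inv_num s T c a =
     (if left_of T a c \<or> in_child T c 0 a then 0
      else if in_child T c (part s c) a \<or> left_of T c a then part s c
      else (THE i. in_child T c i a))"

definition tree_inv :: "weak_comp \<Rightarrow> tree \<Rightarrow> (nat \<times> nat) multiset" where
  "tree_inv s T =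
     Abs_multiset (\<lambda>(c, a). if 1 \<le> a \<and> a < c \<and> c \<le> length s then inv_num s T c a else 0)"

lemma count_tree_inv:
  "count (tree_inv s T) (c, a) =
     (if 1 \<le> a \<and> a < c \<and> c \<le> length s then inv_num s T c a else 0)"
proof -
  let ?f = "\<lambda>(c, a). if 1 \<le> a \<and> a < c \<and> c \<le> length s then inv_num s T c a else 0"
  have "{p. 0 < ?f p} \<subseteq> {..length s} \<times> {..length s}"
    by (auto split: if_splits)
  then have "finite {p. 0 < ?f p}"
    by (rule finite_subset) simp
  then show ?thesis
    unfolding tree_inv_def by simp
qed

definition weak_le :: "weak_comp \<Rightarrow> tree \<Rightarrow> tree \<Rightarrow> bool" where
  "weak_le s R T \<longleftrightarrow>
     (\<forall>a c. 1 \<le> a \<and> a < c \<and> c \<le> length s \<longrightarrow> inv_num s R c a \<le> inv_num s T c a)"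


section \<open>Tamari trees\<close>

definition tamari_trees :: "weak_comp \<Rightarrow> tree set" where
  "tamari_trees s =
     {T. decreasing_tree s T \<and>
         (\<forall>a b c. 1 \<le> a \<and> a < b \<and> b < c \<and> c \<le> length s \<longrightarrow>
            inv_num s T c a \<le> inv_num s T c b)}"

definition tamari_ascents :: "weak_comp \<Rightarrow> tree \<Rightarrow> (nat \<times> nat) set" where
  "tamari_ascents s T =
     {(a, c). a < c \<and> (\<exists>i ts. i < part s c \<and> child_subtree T c i (Node a ts))}"

definition tasc :: "weak_comp \<Rightarrow> tree \<Rightarrow> nat" where
  "tasc s T = card (tamari_ascents s T)"

definition tamari_interval :: "weak_comp \<Rightarrow> tree \<Rightarrow> tree \<Rightarrow> tree set" where
  "tamari_interval s R T = {U \<in> tamari_trees s. weak_le s R U \<and> weak_le s U T}"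

lemma finite_decreasing_tree: "finite {T. decreasing_tree s T}"
proof -
  define D where "D m = {T. set (labels T) \<subseteq> {..<m} \<and>
     (\<forall>y ts. Node y ts \<in> subtrees T \<longrightarrow>
        length ts = part s y + 1 \<and> (\<forall>t\<in>set ts. \<forall>x\<in>set (labels t). x < y))}" for m
  have "finite (D m)" for m
  proof (induction m rule: less_induct)
    case (less m)
    have "T \<in> {Leaf} \<union> (\<Union>y<m. Node y ` {ts. set ts \<subseteq> D y \<and> length ts = part s y + 1})"
      if T: "T \<in> D m" for T
    proof (cases T)
      case (Node y ts)
      have "Node y ts \<in> subtrees T"
        by (simp add: Node)
      then have "length ts = part s y + 1" "\<forall>t\<in>set ts. \<forall>x\<in>set (labels t). x < y"
        using T unfolding D_def by blast+
      moreover have "y < m"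
        using T by (simp add: D_def Node)
      moreover have "subtrees t \<subseteq> subtrees T" if "t \<in> set ts" for t
        using that by (auto simp: Node)
      then have "set ts \<subseteq> D y"
        using T calculation(2) unfolding D_def by blast
      ultimately show ?thesis
        by (auto simp: Node)
    qed simp
    then have "D m \<subseteq> {Leaf} \<union>
        (\<Union>y<m. Node y ` {ts. set ts \<subseteq> D y \<and> length ts = part s y + 1})"
      by blast
    moreover have "finite \<dots>"
      using less.IH by (auto intro: finite_lists_length_eq)
    ultimately show ?case
      by (rule finite_subset)
  qed
  moreover have "{T. decreasing_tree s T} \<subseteq> D (Suc (length s))"
    by (auto simp: decreasing_tree_def D_def)
  ultimately show ?thesis
    using finite_subset by blast
qed

lemma finite_tamari_trees: "finite (tamari_trees s)"
  by (rule finite_subset[OF _ finite_decreasing_tree[of s]]) (auto simp: tamari_trees_def)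


section \<open>Pure intervals and the associahedron\<close>

definition paths :: "(nat \<times> nat) multiset \<Rightarrow> nat \<Rightarrow> nat \<Rightarrow> nat list set" where
  "paths I c a =
     {bs. 2 \<le> length bs \<and> hd bs = c \<and> last bs = a \<and> sorted_wrt (>) bs \<and>
          (\<forall>i. Suc i < length bs \<longrightarrow> count I (bs ! i, bs ! Suc i) > 0)}"

definition trans_closure :: "(nat \<times> nat) multiset \<Rightarrow> (nat \<times> nat) multiset" where
  "trans_closure I =
     Abs_multiset (\<lambda>(c, a). Max (insert 0 ((\<lambda>bs. count I (bs ! 0, bs ! 1)) ` paths I c a)))"

lemma finite_path_counts: "finite ((\<lambda>bs. count I (bs ! 0, bs ! 1)) ` paths I c a)"
proof (rule finite_subset)
  show "(\<lambda>bs. count I (bs ! 0, bs ! 1)) ` paths I c a \<subseteq> count I ` set_mset I"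
    by (force simp: paths_def count_greater_zero_iff)
qed simp

lemma count_trans_closure:
  "count (trans_closure I) (c, a) =
     Max (insert 0 ((\<lambda>bs. count I (bs ! 0, bs ! 1)) ` paths I c a))"
proof -
  let ?f = "\<lambda>(c, a). Max (insert 0 ((\<lambda>bs. count I (bs ! 0, bs ! 1)) ` paths I c a))"
  have "(c, a) \<in> (fst ` set_mset I) \<times> (snd ` set_mset I)" if "0 < ?f (c, a)" for c a
  proof -
    have "paths I c a \<noteq> {}"
      using that by auto
    then obtain bs where bs: "bs \<in> paths I c a"
      by blast
    define k where "k = length bs - 2"
    have k: "length bs = Suc (Suc k)"
      using bs by (auto simp: paths_def k_def)
    then have "(bs ! 0, bs ! 1) \<in># I" "(bs ! k, bs ! Suc k) \<in># I"
      using bs by (auto simp: paths_def)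
    moreover have "bs \<noteq> []"
      using k by auto
    then have "bs ! 0 = c" "bs ! Suc k = a"
      using bs k by (simp_all add: paths_def hd_conv_nth last_conv_nth)
    ultimately show ?thesis
      by force
  qed
  then have "{p. 0 < ?f p} \<subseteq> (fst ` set_mset I) \<times> (snd ` set_mset I)"
    by auto
  then have "finite {p. 0 < ?f p}"
    by (rule finite_subset) simp
  then show ?thesis
    unfolding trans_closure_def by simp
qed

(* T + A. Ascents are written (a, c) but inversions (c, a), hence the swap. *)
definition tree_plus :: "weak_comp \<Rightarrow> tree \<Rightarrow> (nat \<times> nat) set \<Rightarrow> tree" where
  "tree_plus s T A =
     (THE U. U \<in> tamari_trees s \<and>
        tree_inv s U = trans_closure (tree_inv s T + mset_set (prod.swap ` A)))"

(* A face is the set of trees in the interval. *)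
definition Asso :: "weak_comp \<Rightarrow> tree set set" where
  "Asso s = {tamari_interval s T (tree_plus s T A) | T A.
               T \<in> tamari_trees s \<and> A \<subseteq> tamari_ascents s T}"

definition face_dim :: "weak_comp \<Rightarrow> tree set \<Rightarrow> nat" where
  "face_dim s F =
     (THE d. \<exists>T A. T \<in> tamari_trees s \<and> A \<subseteq> tamari_ascents s T \<and>
        F = tamari_interval s T (tree_plus s T A) \<and> d = card A)"

lemma finite_Asso: "finite (Asso s)"
  by (rule finite_subset[of _ "Pow (tamari_trees s)"])
     (auto simp: Asso_def tamari_interval_def finite_tamari_trees)

definition f_polynomial :: "weak_comp \<Rightarrow> int poly" where
  "f_polynomial s = (\<Sum>F\<in>Asso s. monom 1 (face_dim s F))"

end

theory Submission
  imports Defs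
begin

text \<open>The face \<open>[T, T + A]\<close> determines both \<open>T\<close> and \<open>A\<close>. Hence the faces correspond bijectively to the
  pairs \<open>(T, A)\<close> with \<open>A\<close> a set of Tamari-ascents of \<open>T\<close>, the dimension of a face is the size of \<open>A\<close>,
  and the binomial theorem evaluates the sum over \<open>A\<close> to \<open>(1 + t)\<close> raised to the power \<open>tasc T\<close>.

  That \<open>T\<close> and \<open>T + A\<close> are recovered from the face, as its least and greatest element, needs that the
  inversion multiset determines the tree, and that \<open>T + A\<close> exists as a Tamari tree. Both rest on a
  characterisation of inversion numbers. In a Tamari tree a smaller node is never to the right of a
  larger one (\<open>tamari_not_right\<close>), so the numbers \<open>f c a\<close> form a table that is bounded by \<open>s(c)\<close>,
  weakly increasing in \<open>a\<close>, and satisfies \<open>f c b \<le> f c a\<close> whenever \<open>a < b < c\<close> and \<open>f b a > 0\<close>.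
  Conversely each such table is the table of exactly one Tamari tree, obtained by taking the largest
  label \<open>m\<close> as the root and distributing the other labels \<open>a\<close> over its children according to \<open>f m a\<close>.

  The transitive closure that defines \<open>T + A\<close> is transitive by concatenation of paths. Its rows are
  weakly increasing because, for an ascent \<open>(a, c)\<close>, every \<open>b\<close> with \<open>a < b < c\<close> has a strictly larger
  inversion number with \<open>c\<close> than \<open>a\<close> has (\<open>tamari_ascent_less\<close>). The same fact, together with the
  uniqueness of the parent of a node, shows that the closure leaves the inversion number at an ascent
  outside \<open>A\<close> unchanged (\<open>raised_closure_ascent\<close>), while it raises the number at the ascents in \<open>A\<close>;
  so \<open>A\<close> is recovered by comparing \<open>T\<close> with \<open>T + A\<close>.\<close>


section \<open>Positions of nodes in a tree\<close>

lemma subtrees_refl: "T \<in> subtrees T"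
  by (cases T) auto

lemma subtrees_trans: "S \<in> subtrees T \<Longrightarrow> subtrees S \<subseteq> subtrees T"
  by (induction T) auto

lemma labels_subtree: "S \<in> subtrees T \<Longrightarrow> set (labels S) \<subseteq> set (labels T)"
  by (induction T) auto

lemma distinct_labels_child:
  assumes "distinct (labels (Node y ts))" "t \<in> set ts"
  shows "distinct (labels t)"
proof -
  have "labels t \<in> set (map labels ts)"
    using assms(2) by simp
  with assms(1) show ?thesis
    unfolding labels.simps distinct.simps distinct_concat_iff by blast
qed

lemma distinct_labels_subtree:
  "S \<in> subtrees T \<Longrightarrow> distinct (labels T) \<Longrightarrow> distinct (labels S)"
proof (induction T)
  case (Node y ts)
  show ?case
  proof (cases "S = Node y ts")
    case False
    then obtain t where "t \<in> set ts" "S \<in> subtrees t"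
      using Node.prems by auto
    then show ?thesis
      using Node.IH Node.prems(2) distinct_labels_child by blast
  qed (use Node.prems in simp)
qed simp

lemma disjoint_concat_nth:
  assumes "distinct (concat xss)" "i < j" "j < length xss"
  shows "set (xss ! i) \<inter> set (xss ! j) = {}"
  using assms
proof (induction xss arbitrary: i j)
  case (Cons xs xss)
  obtain k where k: "j = Suc k"
    using Cons.prems(2) by (cases j) auto
  show ?case
  proof (cases i)
    case 0
    have "set (xss ! k) \<subseteq> set (concat xss)"
      using Cons.prems(3) k nth_mem[of k xss] by (auto simp del: nth_mem)
    then show ?thesis
      using Cons.prems(1) 0 k by auto
  next
    case (Suc i')
    then show ?thesis
      using Cons k by auto
  qed
qed simp

lemma disjoint_children:
  assumes "distinct (labels (Node y ts))" "i < length ts" "j < length ts"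
    and "x \<in> set (labels (ts ! i))" "x \<in> set (labels (ts ! j))"
  shows "i = j"
proof (rule ccontr)
  assume "i \<noteq> j"
  moreover have "distinct (concat (map labels ts))"
    using assms(1) by simp
  ultimately show False
    using disjoint_concat_nth[of "map labels ts" i j] disjoint_concat_nth[of "map labels ts" j i]
      assms(2-5) by (cases "i < j") auto
qed

lemma label_iff_node: "y \<in> set (labels T) \<longleftrightarrow> (\<exists>ts. Node y ts \<in> subtrees T)"
  by (induction T) auto

lemma node_unique:
  assumes "distinct (labels T)" "Node y ts \<in> subtrees T" "Node y us \<in> subtrees T"
  shows "ts = us"
  using assms
proof (induction T)
  case (Node z vs)
  show ?case
  proof (cases "y = z")
    case True
    have "Node y ws \<notin> subtrees v" if "v \<in> set vs" for v ws
    proof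
      assume "Node y ws \<in> subtrees v"
      then have "y \<in> set (labels v)"
        using label_iff_node by blast
      then show False
        using Node.prems(1) True that by auto
    qed
    then show ?thesis
      using Node.prems(2,3) by auto
  next
    case False
    then obtain v w where v: "v \<in> set vs" "Node y ts \<in> subtrees v"
      and w: "w \<in> set vs" "Node y us \<in> subtrees w"
      using Node.prems(2,3) by auto
    then have "y \<in> set (labels v)" "y \<in> set (labels w)"
      using label_iff_node by blast+
    then have "v = w"
      using disjoint_children[OF Node.prems(1)] v(1) w(1) by (metis in_set_conv_nth)
    then show ?thesis
      using Node.IH Node.prems(1) v w distinct_labels_child by blast
  qed
qed simp

lemma in_child_node:
  assumes "distinct (labels T)" "Node y ts \<in> subtrees T"
  shows "in_child T y i a \<longleftrightarrow> i < length ts \<and> a \<in> set (labels (ts ! i))"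
  using assms node_unique unfolding in_child_def child_subtree_def by blast

lemma in_childE:
  assumes "in_child T y i a"
  obtains ts where "Node y ts \<in> subtrees T" "i < length ts" "a \<in> set (labels (ts ! i))"
  using assms unfolding in_child_def child_subtree_def by blast

lemma in_child_labels:
  assumes "in_child T y i a"
  shows "y \<in> set (labels T)" "a \<in> set (labels T)"
proof -
  obtain ts where ts: "Node y ts \<in> subtrees T" "i < length ts" "a \<in> set (labels (ts ! i))"
    using assms by (rule in_childE)
  then have "y \<in> set (labels (Node y ts))" "a \<in> set (labels (Node y ts))"
    by auto
  then show "y \<in> set (labels T)" "a \<in> set (labels T)"
    using labels_subtree ts(1) by blast+
qed

lemma in_child_unique:
  assumes "distinct (labels T)" "in_child T y i a" "in_child T y j a"
  shows "i = j"
proof -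
  obtain ts where ts: "Node y ts \<in> subtrees T" "i < length ts" "a \<in> set (labels (ts ! i))"
    using assms(2) by (rule in_childE)
  then show ?thesis
    using disjoint_children[OF distinct_labels_subtree[OF ts(1) assms(1)]] assms(1,3)
      in_child_node by blast
qed

lemma in_child_subtree: "S \<in> subtrees T \<Longrightarrow> in_child S y i a \<Longrightarrow> in_child T y i a"
  using subtrees_trans unfolding in_child_def child_subtree_def by blast

lemma left_of_subtree: "S \<in> subtrees T \<Longrightarrow> left_of S a c \<Longrightarrow> left_of T a c"
  using in_child_subtree unfolding left_of_def by blast

lemma child_in_subtrees: "Node y ts \<in> subtrees T \<Longrightarrow> i < length ts \<Longrightarrow> ts ! i \<in> subtrees T"
  using subtrees_trans subtrees_refl by fastforce

lemma in_child_trans: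
  assumes "distinct (labels T)" "in_child T c i b" "in_child T b j a"
  shows "in_child T c i a"
proof -
  obtain ts where ts: "Node c ts \<in> subtrees T" "i < length ts" "b \<in> set (labels (ts ! i))"
    using assms(2) by (rule in_childE)
  then obtain us where us: "Node b us \<in> subtrees (ts ! i)"
    using label_iff_node by blast
  then have "Node b us \<in> subtrees T"
    using child_in_subtrees[OF ts(1,2)] subtrees_trans by blast
  then have "j < length us" "a \<in> set (labels (us ! j))"
    using in_child_node assms(1,3) by blast+
  then have "a \<in> set (labels (Node b us))"
    by auto
  then have "a \<in> set (labels (ts ! i))"
    using labels_subtree us by blast
  then show ?thesis
    using ts assms(1) in_child_node by blast
qed

lemma left_of_in_child:
  assumes "distinct (labels T)"
  shows "left_of T x y \<Longrightarrow> in_child T x i a \<Longrightarrow> left_of T a y"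
    and "left_of T x y \<Longrightarrow> in_child T y i a \<Longrightarrow> left_of T x a"
  using in_child_trans[OF assms] unfolding left_of_def by blast+

lemma not_left_of_refl: "distinct (labels T) \<Longrightarrow> \<not> left_of T a a"
  using in_child_unique unfolding left_of_def by blast

lemma node_position_cases:
  assumes "a \<in> set (labels T)" "c \<in> set (labels T)" "a \<noteq> c"
  obtains i where "in_child T c i a" | i where "in_child T a i c" | "left_of T a c" | "left_of T c a"
proof -
  have "(\<exists>i. in_child T c i a) \<or> (\<exists>i. in_child T a i c) \<or> left_of T a c \<or> left_of T c a"
    using assms
  proof (induction T)
    case (Node y ts)
    have root: "in_child (Node y ts) y i x" if "i < length ts" "x \<in> set (labels (ts ! i))" for i x
      using that subtrees_refl[of "Node y ts"] unfolding in_child_def child_subtree_def by blast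
    have below: "\<exists>i < length ts. x \<in> set (labels (ts ! i))"
      if "x \<in> set (labels (Node y ts))" "x \<noteq> y" for x
      using that by (auto simp: in_set_conv_nth Bex_def)
    show ?case
    proof (cases "a = y \<or> c = y")
      case True
      then show ?thesis
        using root below Node.prems by metis
    next
      case False
      then obtain i j where ij: "i < length ts" "a \<in> set (labels (ts ! i))"
        "j < length ts" "c \<in> set (labels (ts ! j))"
        using below Node.prems by metis
      consider "i < j" | "j < i" | "i = j"
        by linarith
      then show ?thesis
      proof cases
        case 1
        then have "left_of (Node y ts) a c"
          unfolding left_of_def using root[OF ij(1,2)] root[OF ij(3,4)] by blast
        then show ?thesis
          by blast
      next
        case 2
        then have "left_of (Node y ts) c a"
          unfolding left_of_def using root[OF ij(1,2)] root[OF ij(3,4)] by blast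
        then show ?thesis
          by blast
      next
        case 3
        have sub: "ts ! i \<in> subtrees (Node y ts)"
          using child_in_subtrees[OF subtrees_refl ij(1)] .
        have "(\<exists>k. in_child (ts ! i) c k a) \<or> (\<exists>k. in_child (ts ! i) a k c)
            \<or> left_of (ts ! i) a c \<or> left_of (ts ! i) c a"
          using Node.IH[of "ts ! i"] ij 3 Node.prems(3) by simp
        then show ?thesis
          using in_child_subtree[OF sub] left_of_subtree[OF sub] by blast
      qed
    qed
  qed simp
  then show ?thesis
    using that by blast
qed


section \<open>Inversions of decreasing and Tamari trees\<close>

lemma decreasing_tree_distinct: "decreasing_tree s T \<Longrightarrow> distinct (labels T)"
  by (simp add: decreasing_tree_def)

lemma decreasing_tree_labels: "decreasing_tree s T \<Longrightarrow> set (labels T) = {1..length s}"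
  by (simp add: decreasing_tree_def)

lemma decreasing_in_child:
  assumes "decreasing_tree s T" "in_child T c i a"
  shows "a < c" "i \<le> part s c"
proof -
  obtain ts where ts: "Node c ts \<in> subtrees T" "i < length ts" "a \<in> set (labels (ts ! i))"
    using assms(2) by (rule in_childE)
  then have "length ts = part s c + 1" "\<forall>t\<in>set ts. \<forall>x\<in>set (labels t). x < c"
    using assms(1) unfolding decreasing_tree_def by blast+
  then show "a < c" "i \<le> part s c"
    using ts by auto
qed

lemma inv_num_in_child:
  assumes "distinct (labels T)" "in_child T c i a"
  shows "inv_num s T c a = i"
proof -
  have "\<not> left_of T a c" "\<not> left_of T c a"
    using assms left_of_in_child not_left_of_refl by blast+
  moreover have "in_child T c j a \<longleftrightarrow> j = i" for j
    using assms in_child_unique by blast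
  ultimately show ?thesis
    by (simp add: inv_num_def)
qed

lemma inv_num_left_of: "left_of T a c \<Longrightarrow> inv_num s T c a = 0"
  by (simp add: inv_num_def)

lemma tamari_decreasing: "T \<in> tamari_trees s \<Longrightarrow> decreasing_tree s T"
  by (simp add: tamari_trees_def)

lemma tamari_distinct: "T \<in> tamari_trees s \<Longrightarrow> distinct (labels T)"
  using tamari_decreasing decreasing_tree_distinct by blast

lemma tamari_not_right:
  assumes "T \<in> tamari_trees s" "a < c"
  shows "\<not> left_of T c a"
proof
  assume "left_of T c a"
  then obtain y i j where ij: "i < j" "in_child T y i c" "in_child T y j a"
    unfolding left_of_def by blast
  have "c < y" "1 \<le> a" "y \<le> length s"
    using decreasing_in_child(1)[OF tamari_decreasing[OF assms(1)] ij(2)]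
      in_child_labels[OF ij(2)] in_child_labels[OF ij(3)]
      decreasing_tree_labels[OF tamari_decreasing[OF assms(1)]] by auto
  then have "inv_num s T y a \<le> inv_num s T y c"
    using assms by (simp add: tamari_trees_def)
  then show False
    using ij inv_num_in_child tamari_distinct[OF assms(1)] by fastforce
qed

text \<open>In a Tamari tree a node smaller than \<open>c\<close> is either to the left of \<open>c\<close> or a descendant of it;
  it is never to the right. The first case covers also \<open>i = 0\<close>.\<close>

lemma tamari_position_cases:
  assumes "T \<in> tamari_trees s" "1 \<le> a" "a < c" "c \<le> length s"
  obtains i where "in_child T c i a" "inv_num s T c a = i"
        | "left_of T a c" "inv_num s T c a = 0"
proof -
  have "a \<in> set (labels T)" "c \<in> set (labels T)"
    using decreasing_tree_labels[OF tamari_decreasing[OF assms(1)]] assms by auto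
  moreover have "\<not> in_child T a i c" for i
    using decreasing_in_child(1)[OF tamari_decreasing[OF assms(1)]] assms(3) by fastforce
  ultimately show ?thesis
    using node_position_cases[of a T c] that assms tamari_not_right
      inv_num_in_child[OF tamari_distinct[OF assms(1)]] inv_num_left_of by (metis less_irrefl)
qed

text \<open>The tables \<open>f c a\<close> with the properties that characterise the tree-inversions of a Tamari
  tree: they are bounded by \<open>s(c)\<close>, weakly increasing in \<open>a\<close>, and transitive. Only the entries with
  \<open>1 \<le> a < c \<le> n\<close> matter.\<close>

definition tamari_table :: "weak_comp \<Rightarrow> (nat \<Rightarrow> nat \<Rightarrow> nat) \<Rightarrow> bool" where
  "tamari_table s f \<longleftrightarrow>
     (\<forall>a c. 1 \<le> a \<and> a < c \<and> c \<le> length s \<longrightarrow> f c a \<le> part s c) \<and>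
     (\<forall>a b c. 1 \<le> a \<and> a < b \<and> b < c \<and> c \<le> length s \<longrightarrow> f c a \<le> f c b) \<and>
     (\<forall>a b c. 1 \<le> a \<and> a < b \<and> b < c \<and> c \<le> length s \<and> f b a > 0 \<longrightarrow> f c b \<le> f c a)"

lemma tamari_table_bound:
  "tamari_table s f \<Longrightarrow> 1 \<le> a \<Longrightarrow> a < c \<Longrightarrow> c \<le> length s \<Longrightarrow> f c a \<le> part s c"
  by (simp add: tamari_table_def)

lemma tamari_table_mono:
  "tamari_table s f \<Longrightarrow> 1 \<le> a \<Longrightarrow> a < b \<Longrightarrow> b < c \<Longrightarrow> c \<le> length s \<Longrightarrow> f c a \<le> f c b"
  by (simp add: tamari_table_def)

lemma tamari_table_trans:
  "tamari_table s f \<Longrightarrow> 1 \<le> a \<Longrightarrow> a < b \<Longrightarrow> b < c \<Longrightarrow> c \<le> length s \<Longrightarrow> f b a > 0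
     \<Longrightarrow> f c b \<le> f c a"
  by (simp add: tamari_table_def)

lemma tamari_table_inv_num:
  assumes T: "T \<in> tamari_trees s"
  shows "tamari_table s (inv_num s T)"
  unfolding tamari_table_def
proof (intro conjI allI impI; elim conjE)
  fix a c assume ac: "1 \<le> a" "a < c" "c \<le> length s"
  show "inv_num s T c a \<le> part s c"
    using tamari_position_cases[OF T ac] decreasing_in_child(2)[OF tamari_decreasing[OF T]]
    by (metis le0)
next
  fix a b c assume "1 \<le> a" "a < b" "b < c" "c \<le> length s"
  then show "inv_num s T c a \<le> inv_num s T c b"
    using T by (simp add: tamari_trees_def)
next
  fix a b c assume abc: "1 \<le> a" "a < b" "b < c" "c \<le> length s" and pos: "inv_num s T b a > 0"
  have D: "distinct (labels T)"
    using T by (rule tamari_distinct)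
  obtain i where i: "in_child T b i a"
  proof (rule tamari_position_cases[OF T abc(1,2)])
    show "b \<le> length s"
      using abc by simp
  qed (use pos in auto)
  show "inv_num s T c b \<le> inv_num s T c a"
  proof (rule tamari_position_cases[OF T, of b c])
    fix j assume "in_child T c j b" "inv_num s T c b = j"
    then show ?thesis
      using inv_num_in_child[OF D in_child_trans[OF D _ i]] by simp
  qed (use abc in auto)
qed


section \<open>The tree of a table\<close>

text \<open>The tree on the label set \<open>X\<close> in which \<open>a\<close> lies in the child \<open>f c a\<close> of its ancestor \<open>c\<close>: the
  root is the largest label, and the remaining labels are distributed over its children
  according to \<open>f\<close>. An infinite set gives a leaf, so that the recursion is well founded.\<close>

function table_tree :: "weak_comp \<Rightarrow> (nat \<Rightarrow> nat \<Rightarrow> nat) \<Rightarrow> nat set \<Rightarrow> tree" where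
  "table_tree s f X =
     (if X = {} \<or> infinite X then Leaf
      else Node (Max X) (map (\<lambda>i. table_tree s f {a \<in> X. a < Max X \<and> f (Max X) a = i})
                             [0..<part s (Max X) + 1]))"
  by pat_completeness auto
termination
proof (relation "measure (\<lambda>(s, f, X). card X)")
  fix s :: weak_comp and f :: "nat \<Rightarrow> nat \<Rightarrow> nat" and X :: "nat set" and i :: nat
  assume X: "\<not> (X = {} \<or> infinite X)"
  then have "{a \<in> X. a < Max X \<and> f (Max X) a = i} \<subset> X"
    using Max_in[of X] by blast
  then show "((s, f, {a \<in> X. a < Max X \<and> f (Max X) a = i}), s, f, X)
      \<in> measure (\<lambda>(s, f, X). card X)"
    using X by (simp add: psubset_card_mono)
qed simp

declare table_tree.simps [simp del]

lemma table_tree_empty [simp]: "table_tree s f {} = Leaf"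
  by (simp add: table_tree.simps)

lemma table_tree_node:
  "finite X \<Longrightarrow> X \<noteq> {} \<Longrightarrow> table_tree s f X =
     Node (Max X) (map (\<lambda>i. table_tree s f {a \<in> X. a < Max X \<and> f (Max X) a = i})
                       [0..<part s (Max X) + 1])"
  by (simp add: table_tree.simps)

lemma table_tree_labels:
  assumes f: "tamari_table s f" and "X \<subseteq> {1..length s}"
  shows "distinct (labels (table_tree s f X)) \<and> set (labels (table_tree s f X)) = X"
  using assms(2)
proof (induction "card X" arbitrary: X rule: less_induct)
  case less
  have fin: "finite X"
    using less.prems finite_subset by blast
  show ?case
  proof (cases "X = {}")
    case False
    define m where "m = Max X"
    define Y where "Y i = {a \<in> X. a < m \<and> f m a = i}" for i
    have m: "m \<in> X" "\<And>x. x \<in> X \<Longrightarrow> x \<le> m"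
      using fin False by (simp_all add: m_def)
    have IH: "distinct (labels (table_tree s f (Y i)))" "set (labels (table_tree s f (Y i))) = Y i"
      for i
    proof -
      have "Y i \<subset> X"
        using m(1) by (auto simp: Y_def)
      then have "card (Y i) < card X"
        using fin psubset_card_mono by blast
      then show "distinct (labels (table_tree s f (Y i)))"
        "set (labels (table_tree s f (Y i))) = Y i"
        using less.hyps[of "Y i"] less.prems \<open>Y i \<subset> X\<close> by blast+
    qed
    have eq: "labels (table_tree s f X) =
        m # concat (map (\<lambda>i. labels (table_tree s f (Y i))) [0..<part s m + 1])"
      using fin False by (simp add: table_tree_node m_def Y_def comp_def)
    have "X = insert m (\<Union>i\<in>{0..<part s m + 1}. Y i)"
    proof (intro equalityI subsetI)
      fix x assume x: "x \<in> X"
      show "x \<in> insert m (\<Union>i\<in>{0..<part s m + 1}. Y i)"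
      proof (cases "x = m")
        case False
        then have "x < m" "1 \<le> x" "m \<le> length s"
          using m x less.prems by (auto simp: order_less_le)
        then have "f m x \<le> part s m"
          using f tamari_table_bound by blast
        then show ?thesis
          using x \<open>x < m\<close> by (auto simp: Y_def)
      qed simp
    qed (use m(1) in \<open>auto simp: Y_def\<close>)
    then have labels: "set (labels (table_tree s f X)) = X"
      unfolding eq by (simp add: IH(2) del: upt_Suc)
    have "distinct (concat (map (\<lambda>i. labels (table_tree s f (Y i))) [0..<k]))" for k
      proof (induction k)
      case (Suc k)
      have "Y i \<inter> Y k = {}" if "i < k" for i
        using that by (auto simp: Y_def)
      then show ?case
        using Suc by (auto simp: IH disjoint_iff)
    qed simp
    moreover have "m \<notin> Y i" for i
      by (simp add: Y_def)
    ultimately show ?thesis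
      unfolding labels unfolding eq by (auto simp: IH(2) simp del: upt_Suc)
  qed simp
qed

text \<open>Every node of the tree is the root of a subtree that is itself built from the table, so its
  children are the ones prescribed by \<open>f\<close>.\<close>

lemma table_tree_subtree:
  assumes f: "tamari_table s f" and "X \<subseteq> {1..length s}"
    and "Node y ts \<in> subtrees (table_tree s f X)"
  shows "length ts = part s y + 1 \<and>
         (\<forall>i < length ts. \<forall>x \<in> set (labels (ts ! i)). x < y \<and> f y x = i)"
  using assms(2,3)
proof (induction "card X" arbitrary: X rule: less_induct)
  case less
  have fin: "finite X"
    using less.prems finite_subset by blast
  have ne: "X \<noteq> {}"
    using less.prems(2) by auto
  define m where "m = Max X"
  define Y where "Y i = {a \<in> X. a < m \<and> f m a = i}" for i
  have m: "m \<in> X"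
    using fin ne by (simp add: m_def)
  have Y: "Y i \<subset> X" for i
    using m by (auto simp: Y_def)
  have eq: "table_tree s f X = Node m (map (\<lambda>i. table_tree s f (Y i)) [0..<part s m + 1])"
    using fin ne by (simp add: table_tree_node m_def Y_def)
  show ?case
  proof (cases "Node y ts = table_tree s f X")
    case True
    then have y: "y = m" and ts: "ts = map (\<lambda>i. table_tree s f (Y i)) [0..<part s m + 1]"
      using eq by auto
    have "ts ! i = table_tree s f (Y i)" if "i < length ts" for i
      using that unfolding ts by (simp del: upt_Suc)
    moreover have "set (labels (table_tree s f (Y i))) = Y i" for i
      using table_tree_labels[OF f] Y less.prems(1) by (meson order_trans psubset_imp_subset)
    ultimately have "\<forall>i < length ts. \<forall>x \<in> set (labels (ts ! i)). x < y \<and> f y x = i"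
      by (simp add: y Y_def)
    moreover have "length ts = part s y + 1"
      by (simp add: ts y)
    ultimately show ?thesis
      by blast
  next
    case False
    then obtain i where i: "Node y ts \<in> subtrees (table_tree s f (Y i))"
      using less.prems(2) unfolding eq by (auto simp del: upt_Suc)
    have "card (Y i) < card X"
      using fin Y psubset_card_mono by blast
    then show ?thesis
      using less.hyps[OF _ _ i] Y[of i] less.prems(1) by blast
  qed
qed

lemma decreasing_table_tree:
  assumes "tamari_table s f"
  shows "decreasing_tree s (table_tree s f {1..length s})"
  unfolding decreasing_tree_def
proof (intro conjI allI impI ballI)
  fix y ts assume node: "Node y ts \<in> subtrees (table_tree s f {1..length s})"
  note children = table_tree_subtree[OF assms order_refl node]
  then show "length ts = part s y + 1"
    by blast
  fix t x assume "t \<in> set ts" "x \<in> set (labels t)"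
  then show "x < y"
    using children by (metis in_set_conv_nth)
qed (use table_tree_labels[OF assms order_refl] in blast)+

lemma inv_num_table_tree:
  assumes f: "tamari_table s f" and ac: "1 \<le> a" "a < c" "c \<le> length s"
  shows "inv_num s (table_tree s f {1..length s}) c a = f c a"
proof -
  let ?U = "table_tree s f {1..length s}"
  have dec: "decreasing_tree s ?U"
    using f by (rule decreasing_table_tree)
  have D: "distinct (labels ?U)"
    using dec by (rule decreasing_tree_distinct)
  have L: "set (labels ?U) = {1..length s}"
    using dec by (rule decreasing_tree_labels)
  have child: "x < y" "f y x = i" if "in_child ?U y i x" for x y i
    using that table_tree_subtree[OF f order_refl] by (meson in_childE)+
  consider i where "in_child ?U c i a" | i where "in_child ?U a i c" | "left_of ?U a c"
    | "left_of ?U c a"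
    using node_position_cases[of a ?U c] L ac by auto
  then show ?thesis
  proof cases
    case 1
    then show ?thesis
      using inv_num_in_child[OF D] child(2) by simp
  next
    case 2
    then show ?thesis
      using child(1) ac(2) by fastforce
  next
    case 3
    then obtain y i j where y: "i < j" "in_child ?U y i a" "in_child ?U y j c"
      unfolding left_of_def by blast
    then have "c < y" "f y a < f y c" "y \<le> length s"
      using child in_child_labels(1)[OF y(2)] L by auto
    then have "f c a = 0"
      using tamari_table_trans[OF f ac(1,2)] by fastforce
    then show ?thesis
      using inv_num_left_of[OF 3] by simp
  next
    case 4
    then obtain y i j where y: "i < j" "in_child ?U y i c" "in_child ?U y j a"
      unfolding left_of_def by blast
    then have "c < y" "f y c < f y a" "y \<le> length s"
      using child in_child_labels(1)[OF y(2)] L by auto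
    then show ?thesis
      using tamari_table_mono[OF f ac(1,2)] by fastforce
  qed
qed

lemma table_tree_tamari:
  assumes "tamari_table s f"
  shows "table_tree s f {1..length s} \<in> tamari_trees s"
  unfolding tamari_trees_def
proof (intro CollectI conjI allI impI; (elim conjE)?)
  fix a b c assume "1 \<le> a" "a < b" "b < c" "c \<le> length s"
  then show "inv_num s (table_tree s f {1..length s}) c a
      \<le> inv_num s (table_tree s f {1..length s}) c b"
    using inv_num_table_tree[OF assms] tamari_table_mono[OF assms] by simp
qed (rule decreasing_table_tree[OF assms])

text \<open>This gives uniqueness of the tree with a given table: a decreasing tree is rebuilt from any table that records, for each node and each descendant
  of it, the child that contains the descendant.\<close>

lemma table_tree_rebuild:
  assumes T: "decreasing_tree s T"
    and f: "\<And>c i a. in_child T c i a \<Longrightarrow> f c a = i"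
    and S: "S \<in> subtrees T"
  shows "table_tree s f (set (labels S)) = S"
  using S
proof (induction S)
  case (Node y ts)
  have ts: "length ts = part s y + 1" "\<forall>t\<in>set ts. \<forall>x\<in>set (labels t). x < y"
    using T Node.prems unfolding decreasing_tree_def by blast+
  have max: "Max (set (labels (Node y ts))) = y"
    using ts(2) by (intro Max_eqI) (auto intro: less_imp_le)
  have child: "{a \<in> set (labels (Node y ts)). a < y \<and> f y a = i} = set (labels (ts ! i))"
    if i: "i < length ts" for i
  proof (intro equalityI subsetI)
    fix a assume a: "a \<in> {a \<in> set (labels (Node y ts)). a < y \<and> f y a = i}"
    then obtain j where j: "j < length ts" "a \<in> set (labels (ts ! j))"
      by (auto simp: in_set_conv_nth Bex_def)
    then have "in_child T y j a"
      using Node.prems unfolding in_child_def child_subtree_def by blast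
    then have "j = i"
      using f a by auto
    then show "a \<in> set (labels (ts ! i))"
      using j by simp
  next
    fix a assume a: "a \<in> set (labels (ts ! i))"
    then have "in_child T y i a"
      using Node.prems i unfolding in_child_def child_subtree_def by blast
    then show "a \<in> {a \<in> set (labels (Node y ts)). a < y \<and> f y a = i}"
      using f ts(2) i a by auto
  qed
  have "table_tree s f (set (labels (Node y ts))) =
      Node y (map (\<lambda>i. table_tree s f (set (labels (ts ! i)))) [0..<length ts])"
    using table_tree_node[OF finite_set, of "labels (Node y ts)" s f] child ts(1)
    unfolding max by (simp del: upt_Suc)
  also have "map (\<lambda>i. table_tree s f (set (labels (ts ! i)))) [0..<length ts] = ts"
    using Node.IH child_in_subtrees[OF Node.prems] by (intro nth_equalityI) auto
  finally show ?case .
qed simp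

lemma tamari_tree_eqI:
  assumes T: "T \<in> tamari_trees s" and U: "U \<in> tamari_trees s"
    and eq: "\<And>a c. 1 \<le> a \<Longrightarrow> a < c \<Longrightarrow> c \<le> length s \<Longrightarrow> inv_num s T c a = inv_num s U c a"
  shows "T = U"
proof -
  have rebuild: "table_tree s (inv_num s T) {1..length s} = V"
    if V: "V \<in> tamari_trees s"
      and agree: "\<And>a c. 1 \<le> a \<Longrightarrow> a < c \<Longrightarrow> c \<le> length s \<Longrightarrow>
        inv_num s T c a = inv_num s V c a" for V
  proof -
    have dec: "decreasing_tree s V"
      using V by (rule tamari_decreasing)
    have "inv_num s T c a = i" if i: "in_child V c i a" for c i a
    proof -
      have "1 \<le> a" "a < c" "c \<le> length s"
        using in_child_labels[OF i] decreasing_tree_labels[OF dec] decreasing_in_child[OF dec i]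
        by auto
      then show ?thesis
        using agree inv_num_in_child[OF tamari_distinct[OF V] i] by simp
    qed
    then show ?thesis
      using table_tree_rebuild[OF dec _ subtrees_refl] decreasing_tree_labels[OF dec] by metis
  qed
  show ?thesis
    using rebuild[OF T] rebuild[OF U] eq by simp
qed


section \<open>Tamari-ascents\<close>

lemma tamari_ascentE:
  assumes "(a, c) \<in> tamari_ascents s T"
  obtains i ts us where "a < c" "i < part s c" "Node c ts \<in> subtrees T" "i < length ts"
    "ts ! i = Node a us" "in_child T c i a"
proof -
  obtain i ts us where "a < c" "i < part s c" "Node c ts \<in> subtrees T" "i < length ts"
    "ts ! i = Node a us"
    using assms unfolding tamari_ascents_def child_subtree_def by (clarsimp, metis)
  moreover from this have "in_child T c i a"
    unfolding in_child_def child_subtree_def by force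
  ultimately show ?thesis
    using that by blast
qed

lemma tamari_ascent_bounds:
  assumes "T \<in> tamari_trees s" "(a, c) \<in> tamari_ascents s T"
  shows "1 \<le> a" "a < c" "c \<le> length s" "inv_num s T c a < part s c"
proof -
  obtain i where i: "a < c" "i < part s c" "in_child T c i a"
    using assms(2) by (blast elim: tamari_ascentE)
  show "a < c"
    using i(1) .
  show "1 \<le> a" "c \<le> length s"
    using in_child_labels[OF i(3)] decreasing_tree_labels[OF tamari_decreasing[OF assms(1)]]
    by auto
  show "inv_num s T c a < part s c"
    using inv_num_in_child[OF tamari_distinct[OF assms(1)] i(3)] i(2) by simp
qed

lemma finite_tamari_ascents: "T \<in> tamari_trees s \<Longrightarrow> finite (tamari_ascents s T)"
  by (rule finite_subset[of _ "{..length s} \<times> {..length s}"])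
     (use tamari_ascent_bounds in fastforce)+

lemma tamari_ascent_below:
  assumes T: "T \<in> tamari_trees s" and ac: "(a, c) \<in> tamari_ascents s T"
    and child: "in_child T c (inv_num s T c a) b"
  shows "b \<le> a"
proof -
  have D: "distinct (labels T)"
    using T by (rule tamari_distinct)
  obtain i ts us where i: "Node c ts \<in> subtrees T" "i < length ts" "ts ! i = Node a us"
    "in_child T c i a"
    using ac by (rule tamari_ascentE)
  have "b \<in> set (labels (Node a us))"
    using child inv_num_in_child[OF D i(4)] in_child_node[OF D i(1)] i(3) by simp
  moreover have "Node a us \<in> subtrees T"
    using child_in_subtrees[OF i(1,2)] i(3) by simp
  then have "\<forall>t\<in>set us. \<forall>x\<in>set (labels t). x < a"
    using tamari_decreasing[OF T] unfolding decreasing_tree_def by blast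
  ultimately show ?thesis
    by (auto intro: less_imp_le)
qed

text \<open>The root of a non-right child of \<open>c\<close> is the largest label less than \<open>c\<close> with its inversion
  number; hence raising that number by one keeps the row of \<open>c\<close> weakly increasing.\<close>

lemma tamari_ascent_less:
  assumes T: "T \<in> tamari_trees s" and ac: "(a, c) \<in> tamari_ascents s T"
    and b: "a < b" "b < c"
  shows "inv_num s T c a < inv_num s T c b"
proof -
  have D: "distinct (labels T)"
    using T by (rule tamari_distinct)
  note ac' = tamari_ascent_bounds[OF T ac]
  have le: "inv_num s T c a \<le> inv_num s T c b"
    using tamari_table_mono[OF tamari_table_inv_num[OF T]] ac' b by blast
  obtain i where i: "in_child T c i a"
    using ac by (blast elim: tamari_ascentE)
  have "1 \<le> b"
    using b ac'(1) by simp
  then show ?thesis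
  proof (rule tamari_position_cases[OF T _ b(2) ac'(3)])
    fix j assume "in_child T c j b" "inv_num s T c b = j"
    then show ?thesis
      using tamari_ascent_below[OF T ac] b(1) le by (metis le_neq_implies_less not_le)
  next
    assume "left_of T b c"
    then have "left_of T b a"
      using left_of_in_child(2)[OF D] i by blast
    then show ?thesis
      using tamari_not_right[OF T b(1)] by blast
  qed
qed

lemma tamari_ascent_parent_unique:
  assumes T: "T \<in> tamari_trees s"
    and ac: "(a, c) \<in> tamari_ascents s T" and ae: "(a, e) \<in> tamari_ascents s T" and "e < c"
  shows False
proof -
  have D: "distinct (labels T)"
    using T by (rule tamari_distinct)
  note ae' = tamari_ascent_bounds[OF T ae]
  obtain i where i: "in_child T c i a"
    using ac by (rule tamari_ascentE)
  obtain j where j: "in_child T e j a"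
    using ae by (rule tamari_ascentE)
  have "1 \<le> e"
    using ae' by simp
  then show False
  proof (rule tamari_position_cases[OF T _ \<open>e < c\<close> tamari_ascent_bounds(3)[OF T ac]])
    fix k assume k: "in_child T c k e"
    then have "k = i"
      using in_child_trans[OF D k j] i in_child_unique[OF D] by blast
    then have "e \<le> a"
      using tamari_ascent_below[OF T ac] k inv_num_in_child[OF D i] by simp
    then show False
      using ae'(2) by simp
  next
    assume "left_of T e c"
    then have "left_of T a a"
      using left_of_in_child[OF D] i j by blast
    then show False
      using not_left_of_refl[OF D] by blast
  qed
qed


section \<open>Transitive closures\<close>

text \<open>The relation whose chains are the paths of \<open>I\<close>.\<close>

abbreviation support_rel :: "(nat \<times> nat) multiset \<Rightarrow> nat \<Rightarrow> nat \<Rightarrow> bool" where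
  "support_rel I x y \<equiv> (x, y) \<in># I"

lemma rtranclp_iff_successively:
  "P\<^sup>*\<^sup>* x y \<longleftrightarrow> (\<exists>bs. bs \<noteq> [] \<and> hd bs = x \<and> last bs = y \<and> successively P bs)"
proof
  assume "P\<^sup>*\<^sup>* x y"
  then show "\<exists>bs. bs \<noteq> [] \<and> hd bs = x \<and> last bs = y \<and> successively P bs"
  proof (induction rule: converse_rtranclp_induct)
    case base
    then show ?case
      by (intro exI[of _ "[y]"]) simp
  next
    case (step x z)
    then obtain bs where "bs \<noteq> []" "hd bs = z" "last bs = y" "successively P bs"
      by blast
    then show ?case
      using step(1) by (intro exI[of _ "x # bs"]) (simp add: successively_Cons)
  qed
next
  have "P\<^sup>*\<^sup>* (hd bs) (last bs)" if "bs \<noteq> []" "successively P bs" for bs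
    using that
  proof (induction bs)
    case (Cons b bs)
    then show ?case
      by (cases "bs = []") (auto simp: successively_Cons intro: converse_rtranclp_into_rtranclp)
  qed simp
  then show "\<exists>bs. bs \<noteq> [] \<and> hd bs = x \<and> last bs = y \<and> successively P bs \<Longrightarrow> P\<^sup>*\<^sup>* x y"
    by blast
qed

text \<open>Paths are traded for reachability: only the first step of a path contributes to its value,
  and the rest of it merely has to lead to \<open>a\<close>. Strict decrease of paths comes for free when \<open>I\<close>
  consists of pairs \<open>(x, y)\<close> with \<open>y < x\<close>.\<close>

lemma le_count_trans_closure_iff:
  assumes dec: "\<And>x y. (x, y) \<in># I \<Longrightarrow> y < x" and v: "0 < v"
  shows "v \<le> count (trans_closure I) (c, a) \<longleftrightarrow>
         (\<exists>d. v \<le> count I (c, d) \<and> (support_rel I)\<^sup>*\<^sup>* d a)"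
proof -
  have paths: "bs \<in> paths I c a \<longleftrightarrow>
      2 \<le> length bs \<and> hd bs = c \<and> last bs = a \<and> successively (support_rel I) bs" for bs
  proof -
    have "sorted_wrt (>) bs" if "successively (support_rel I) bs"
    proof -
      have "successively (>) bs"
        using that dec by (rule successively_mono) auto
      then show ?thesis
        by (simp add: successively_conv_sorted_wrt transp_on_def)
    qed
    then show ?thesis
      unfolding paths_def by (auto simp: successively_conv_nth)
  qed
  have "v \<le> count (trans_closure I) (c, a) \<longleftrightarrow> (\<exists>bs\<in>paths I c a. v \<le> count I (bs ! 0, bs ! 1))"
    using v finite_path_counts[of I c a] by (auto simp: count_trans_closure Max_ge_iff)
  also have "\<dots> \<longleftrightarrow> (\<exists>d bs. v \<le> count I (c, d) \<and> bs \<noteq> [] \<and> hd bs = d \<and> last bs = a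
      \<and> successively (support_rel I) bs)" (is "_ \<longleftrightarrow> ?R")
  proof
    assume "\<exists>bs\<in>paths I c a. v \<le> count I (bs ! 0, bs ! 1)"
    then obtain bs where bs: "bs \<in> paths I c a" "v \<le> count I (bs ! 0, bs ! 1)"
      by blast
    then obtain d ds where "bs = c # d # ds"
      unfolding paths by (cases bs; cases "tl bs") auto
    then show ?R
      using bs unfolding paths by (intro exI[of _ d] exI[of _ "d # ds"]) auto
  next
    assume ?R
    then obtain d bs where bs: "v \<le> count I (c, d)" "bs \<noteq> []" "hd bs = d" "last bs = a"
      "successively (support_rel I) bs"
      by blast
    moreover from bs(1) v have "(c, d) \<in># I"
      using count_greater_zero_iff by fastforce
    ultimately have "c # bs \<in> paths I c a"
      unfolding paths by (cases bs) (auto simp: successively_Cons)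
    then show "\<exists>bs\<in>paths I c a. v \<le> count I (bs ! 0, bs ! 1)"
      using bs by (intro bexI[of _ "c # bs"]) (auto simp: hd_conv_nth)
  qed
  also have "\<dots> \<longleftrightarrow> (\<exists>d. v \<le> count I (c, d) \<and> (support_rel I)\<^sup>*\<^sup>* d a)"
    unfolding rtranclp_iff_successively by blast
  finally show ?thesis .
qed


section \<open>The tree \<open>T + A\<close>\<close>

text \<open>The inversion multiset of \<open>T\<close> raised by one at each ascent in \<open>A\<close>.\<close>

definition raised_inv :: "weak_comp \<Rightarrow> tree \<Rightarrow> (nat \<times> nat) set \<Rightarrow> (nat \<times> nat) multiset" where
  "raised_inv s T A = tree_inv s T + mset_set (prod.swap ` A)"

context
  fixes s :: weak_comp and T :: tree and A :: "(nat \<times> nat) set"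
  assumes T: "T \<in> tamari_trees s" and A: "A \<subseteq> tamari_ascents s T"
begin

lemma count_raised_inv:
  "count (raised_inv s T A) (c, a) =
     (if 1 \<le> a \<and> a < c \<and> c \<le> length s then inv_num s T c a + of_bool ((a, c) \<in> A) else 0)"
proof -
  have "finite A"
    using A finite_tamari_ascents[OF T] finite_subset by blast
  then have "count (raised_inv s T A) (c, a) = count (tree_inv s T) (c, a) + of_bool ((a, c) \<in> A)"
    by (auto simp: raised_inv_def count_mset_set' image_iff Bex_def)
  moreover have "1 \<le> a \<and> a < c \<and> c \<le> length s" if "(a, c) \<in> A"
    using that A tamari_ascent_bounds[OF T] by blast
  ultimately show ?thesis
    by (auto simp: count_tree_inv)
qed

lemma raised_inv_bounds:
  assumes "(c, a) \<in># raised_inv s T A"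
  shows "1 \<le> a" "a < c" "c \<le> length s"
proof -
  have "count (raised_inv s T A) (c, a) \<noteq> 0"
    using assms by simp
  then show "1 \<le> a" "a < c" "c \<le> length s"
    unfolding count_raised_inv by (auto split: if_splits)
qed

lemma raised_reach_le: "(support_rel (raised_inv s T A))\<^sup>*\<^sup>* d a \<Longrightarrow> a \<le> d"
  by (induction rule: rtranclp_induct) (use raised_inv_bounds(2) in \<open>fastforce+\<close>)

lemma le_raised_closure_iff:
  "0 < v \<Longrightarrow> v \<le> count (trans_closure (raised_inv s T A)) (c, a) \<longleftrightarrow>
    (\<exists>d. v \<le> count (raised_inv s T A) (c, d) \<and> (support_rel (raised_inv s T A))\<^sup>*\<^sup>* d a)"
  using raised_inv_bounds(2) by (rule le_count_trans_closure_iff)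

lemma mem_raised_closure_iff:
  "(c, a) \<in># trans_closure (raised_inv s T A) \<longleftrightarrow> (support_rel (raised_inv s T A))\<^sup>+\<^sup>+ c a"
proof -
  have "(c, a) \<in># trans_closure (raised_inv s T A) \<longleftrightarrow>
      (\<exists>d. 1 \<le> count (raised_inv s T A) (c, d) \<and> (support_rel (raised_inv s T A))\<^sup>*\<^sup>* d a)"
    using le_raised_closure_iff[of 1 c a] by (simp add: Suc_le_eq)
  also have "\<dots> \<longleftrightarrow> (support_rel (raised_inv s T A))\<^sup>+\<^sup>+ c a"
    by (auto simp: Suc_le_eq dest: tranclpD intro: rtranclp_into_tranclp2)
  finally show ?thesis .
qed

lemma raised_le_closure:
  "count (raised_inv s T A) (c, a) \<le> count (trans_closure (raised_inv s T A)) (c, a)"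
  using le_raised_closure_iff[of "count (raised_inv s T A) (c, a)" c a]
  by (cases "count (raised_inv s T A) (c, a) = 0") auto

lemma raised_closure_bounds:
  assumes "(c, a) \<in># trans_closure (raised_inv s T A)"
  shows "1 \<le> a" "a < c" "c \<le> length s"
proof -
  have reach: "(support_rel (raised_inv s T A))\<^sup>+\<^sup>+ c a"
    using assms by (simp only: mem_raised_closure_iff)
  obtain d where d: "(c, d) \<in># raised_inv s T A" "(support_rel (raised_inv s T A))\<^sup>*\<^sup>* d a"
    using reach by (meson tranclpD)
  show "a < c" "c \<le> length s"
    using raised_inv_bounds[OF d(1)] raised_reach_le[OF d(2)] by simp_all
  show "1 \<le> a"
    using reach raised_inv_bounds(1) by (cases rule: tranclp.cases) auto
qed

text \<open>Let \<open>d\<close> be the second node of a path from \<open>c\<close> to \<open>a\<close> that attains the maximum. If \<open>d < b\<close>, then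
  the single step from \<open>c\<close> to \<open>b\<close> is at least as large as the one from \<open>c\<close> to \<open>d\<close>, raised or not.
  If \<open>b < d\<close>, then monotonicity in the row of \<open>d\<close> yields a path from \<open>d\<close> to \<open>b\<close>, to which the step
  from \<open>c\<close> to \<open>d\<close> is prepended.\<close>

lemma raised_closure_mono:
  assumes "1 \<le> a" "a < b" "b < c" "c \<le> length s"
  shows "count (trans_closure (raised_inv s T A)) (c, a)
       \<le> count (trans_closure (raised_inv s T A)) (c, b)"
  using assms
proof (induction c arbitrary: a b rule: less_induct)
  case (less c)
  let ?I = "raised_inv s T A"
  let ?g = "\<lambda>c a. count (trans_closure ?I) (c, a)"
  show "?g c a \<le> ?g c b"
  proof (cases "?g c a = 0")
    case False
    then obtain d where d: "?g c a \<le> count ?I (c, d)" "(support_rel ?I)\<^sup>*\<^sup>* d a"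
      using le_raised_closure_iff[of "?g c a" c a] by auto
    then have "(c, d) \<in># ?I"
      using False by (metis count_eq_zero_iff le_zero_eq)
    then have dc: "1 \<le> d" "d < c" "c \<le> length s"
      by (rule raised_inv_bounds)+
    consider "d < b" | "d = b" | "b < d"
      by linarith
    then show ?thesis
    proof cases
      case 1
      have "count ?I (c, d) \<le> count ?I (c, b)"
      proof (cases "(d, c) \<in> A")
        case True
        then show ?thesis
          using tamari_ascent_less[OF T _ 1 less.prems(3)] A dc less.prems
          by (fastforce simp: count_raised_inv)
      next
        case False
        then show ?thesis
          using tamari_table_mono[OF tamari_table_inv_num[OF T] dc(1) 1 less.prems(3,4)] dc 1
            less.prems by (simp add: count_raised_inv)
      qed
      then show ?thesis
        using d(1) raised_le_closure[of c b] by linarith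
    next
      case 2
      then show ?thesis
        using d(1) raised_le_closure[of c b] by auto
    next
      case 3
      then have "(support_rel ?I)\<^sup>+\<^sup>+ d a"
        using d(2) less.prems(2) by (metis less_trans rtranclpD less_irrefl)
      then have "0 < ?g d a"
        by (simp add: mem_raised_closure_iff)
      also have "?g d a \<le> ?g d b"
        using less.IH[OF dc(2) less.prems(1,2) 3] dc by simp
      finally have "(support_rel ?I)\<^sup>*\<^sup>* d b"
        by (simp add: mem_raised_closure_iff tranclp_into_rtranclp)
      then show ?thesis
        using d(1) False le_raised_closure_iff[of "?g c a" c b] by auto
    qed
  qed simp
qed

lemma tamari_table_raised_closure:
  "tamari_table s (\<lambda>c a. count (trans_closure (raised_inv s T A)) (c, a))"
proof -
  let ?I = "raised_inv s T A"
  let ?g = "\<lambda>c a. count (trans_closure ?I) (c, a)"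
  have bound: "count ?I (c, d) \<le> part s c" for c d
  proof (cases "1 \<le> d \<and> d < c \<and> c \<le> length s")
    case True
    then show ?thesis
      using tamari_table_bound[OF tamari_table_inv_num[OF T], of d c]
        tamari_ascent_bounds(4)[OF T, of d c] A
      by (auto simp: count_raised_inv Suc_le_eq)
  qed (auto simp: count_raised_inv)
  have "?g c a \<le> part s c" for c a
    using le_raised_closure_iff[of "?g c a" c a] bound[of c] order_trans
    by (cases "?g c a = 0") auto
  moreover have "?g c b \<le> ?g c a" if "0 < ?g b a" for a b c
  proof (cases "?g c b = 0")
    case False
    then obtain d where d: "?g c b \<le> count ?I (c, d)" "(support_rel ?I)\<^sup>*\<^sup>* d b"
      using le_raised_closure_iff[of "?g c b" c b] by auto
    moreover have "(support_rel ?I)\<^sup>*\<^sup>* b a"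
      using that by (simp add: mem_raised_closure_iff tranclp_into_rtranclp)
    ultimately show ?thesis
      using False le_raised_closure_iff[of "?g c b" c a] rtranclp_trans by fastforce
  qed simp
  ultimately show ?thesis
    unfolding tamari_table_def using raised_closure_mono by blast
qed

text \<open>The closure leaves the ascents outside \<open>A\<close> unchanged, so \<open>A\<close> can be read off from it.\<close>

lemma raised_closure_ascent:
  assumes ac: "(a, c) \<in> tamari_ascents s T" and nA: "(a, c) \<notin> A"
  shows "count (trans_closure (raised_inv s T A)) (c, a) = inv_num s T c a"
proof (rule antisym)
  let ?I = "raised_inv s T A"
  note ac' = tamari_ascent_bounds[OF T ac]
  have ca: "count ?I (c, a) = inv_num s T c a"
    using ac' nA by (simp add: count_raised_inv)
  then show "inv_num s T c a \<le> count (trans_closure ?I) (c, a)"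
    using raised_le_closure[of c a] by simp
  show "count (trans_closure ?I) (c, a) \<le> inv_num s T c a"
  proof (rule ccontr)
    assume "\<not> ?thesis"
    then obtain d where d: "Suc (inv_num s T c a) \<le> count ?I (c, d)" "(support_rel ?I)\<^sup>*\<^sup>* d a"
      using le_raised_closure_iff[of "Suc (inv_num s T c a)" c a] by (auto simp: Suc_le_eq)
    have "d \<noteq> a"
      using d(1) ca by auto
    \<comment> \<open>The last step of the path enters \<open>a\<close> from some \<open>e\<close> strictly between \<open>a\<close> and \<open>c\<close>.\<close>
    then obtain e where e: "(support_rel ?I)\<^sup>*\<^sup>* d e" "(e, a) \<in># ?I"
      using d(2) by (auto elim: rtranclp.cases)
    have "(c, d) \<in># ?I"
      using d(1) by (metis Suc_le_D count_eq_zero_iff nat.distinct(1))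
    then have "e < c"
      using raised_inv_bounds(2) raised_reach_le[OF e(1)] by fastforce
    have ea: "1 \<le> a" "a < e" "e \<le> length s"
      using raised_inv_bounds[OF e(2)] .
    show False
    proof (cases "(a, e) \<in> A")
      case True
      then show False
        using tamari_ascent_parent_unique[OF T ac _ \<open>e < c\<close>] A by blast
    next
      case False
      then have "count ?I (e, a) = inv_num s T e a"
        using ea by (simp add: count_raised_inv)
      then have "inv_num s T e a > 0"
        using e(2) by (metis count_greater_zero_iff)
      then have "inv_num s T c e \<le> inv_num s T c a"
        using tamari_table_trans[OF tamari_table_inv_num[OF T] ea(1,2) \<open>e < c\<close> ac'(3)] by simp
      then show False
        using tamari_ascent_less[OF T ac ea(2) \<open>e < c\<close>] by simp
    qed
  qed
qed

lemma tree_plus: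
  shows tree_plus_tamari: "tree_plus s T A \<in> tamari_trees s"
    and tree_inv_tree_plus: "tree_inv s (tree_plus s T A) = trans_closure (raised_inv s T A)"
proof -
  let ?g = "\<lambda>c a. count (trans_closure (raised_inv s T A)) (c, a)"
  let ?U = "table_tree s ?g {1..length s}"
  have U: "?U \<in> tamari_trees s"
    using tamari_table_raised_closure by (rule table_tree_tamari)
  have inv: "tree_inv s ?U = trans_closure (raised_inv s T A)"
  proof (rule multiset_eqI)
    fix p :: "nat \<times> nat"
    obtain c a where p: "p = (c, a)"
      by fastforce
    show "count (tree_inv s ?U) p = count (trans_closure (raised_inv s T A)) p"
    proof (cases "1 \<le> a \<and> a < c \<and> c \<le> length s")
      case True
      then show ?thesis
        unfolding p count_tree_inv
        using inv_num_table_tree[OF tamari_table_raised_closure, of a c] by simp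
    next
      case False
      then have "count (trans_closure (raised_inv s T A)) (c, a) = 0"
        using raised_closure_bounds[of c a] not_in_iff by metis
      then show ?thesis
        using False unfolding p count_tree_inv by auto
    qed
  qed
  have unique: "V = ?U"
    if V: "V \<in> tamari_trees s \<and> tree_inv s V = trans_closure (raised_inv s T A)" for V
  proof (rule tamari_tree_eqI[OF _ U])
    fix a c assume "1 \<le> a" "a < c" "c \<le> length s"
    then show "inv_num s V c a = inv_num s ?U c a"
      using V inv count_tree_inv[of s V c a] count_tree_inv[of s ?U c a] by simp
  qed (use V in blast)
  have "tree_plus s T A = (THE U. U \<in> tamari_trees s \<and>
      tree_inv s U = trans_closure (raised_inv s T A))"
    by (simp add: tree_plus_def raised_inv_def)
  also have "\<dots> = ?U"
    using U inv unique by (intro the_equality) blast+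
  finally show "tree_plus s T A \<in> tamari_trees s"
    "tree_inv s (tree_plus s T A) = trans_closure (raised_inv s T A)"
    using U inv by simp_all
qed

lemma inv_num_tree_plus:
  assumes "1 \<le> a" "a < c" "c \<le> length s"
  shows "inv_num s (tree_plus s T A) c a = count (trans_closure (raised_inv s T A)) (c, a)"
  using tree_inv_tree_plus count_tree_inv[of s "tree_plus s T A" c a] assms by simp

lemma weak_le_tree_plus: "weak_le s T (tree_plus s T A)"
  unfolding weak_le_def
proof (intro allI impI)
  fix a c assume ac: "1 \<le> a \<and> a < c \<and> c \<le> length s"
  then show "inv_num s T c a \<le> inv_num s (tree_plus s T A) c a"
    using inv_num_tree_plus[of a c] raised_le_closure[of c a] by (simp add: count_raised_inv)
qed

lemma ascents_from_tree_plus: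
  "A = {(a, c) \<in> tamari_ascents s T. inv_num s T c a < inv_num s (tree_plus s T A) c a}"
proof -
  have "inv_num s T c a < inv_num s (tree_plus s T A) c a \<longleftrightarrow> (a, c) \<in> A"
    if ac: "(a, c) \<in> tamari_ascents s T" for a c
  proof -
    note ac' = tamari_ascent_bounds[OF T ac]
    show ?thesis
      using inv_num_tree_plus[OF ac'(1-3)] raised_le_closure[of c a] ac'
        raised_closure_ascent[OF ac] by (cases "(a, c) \<in> A") (auto simp: count_raised_inv)
  qed
  then show ?thesis
    using A by auto
qed

end


section \<open>Faces and the f-polynomial\<close>

lemma weak_le_refl: "weak_le s T T"
  by (simp add: weak_le_def)

lemma weak_le_antisym:
  "T \<in> tamari_trees s \<Longrightarrow> U \<in> tamari_trees s \<Longrightarrow> weak_le s T U \<Longrightarrow> weak_le s U T \<Longrightarrow> T = U"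
  unfolding weak_le_def by (rule tamari_tree_eqI) (auto intro: antisym)

lemma tamari_interval_eqD:
  assumes "R \<in> tamari_trees s" "T \<in> tamari_trees s" "weak_le s R T"
    and "R' \<in> tamari_trees s" "T' \<in> tamari_trees s" "weak_le s R' T'"
    and eq: "tamari_interval s R T = tamari_interval s R' T'"
  shows "R = R'" "T = T'"
proof -
  have "R \<in> tamari_interval s R T" "T \<in> tamari_interval s R T"
    "R' \<in> tamari_interval s R' T'" "T' \<in> tamari_interval s R' T'"
    using assms weak_le_refl by (auto simp: tamari_interval_def)
  then have "R \<in> tamari_interval s R' T'" "T \<in> tamari_interval s R' T'"
    "R' \<in> tamari_interval s R T" "T' \<in> tamari_interval s R T"
    using eq by simp_all
  then show "R = R'" "T = T'"
    using assms weak_le_antisym by (auto simp: tamari_interval_def)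
qed

lemma face_eqD:
  assumes T: "T \<in> tamari_trees s" "A \<subseteq> tamari_ascents s T"
    and U: "U \<in> tamari_trees s" "B \<subseteq> tamari_ascents s U"
    and eq: "tamari_interval s T (tree_plus s T A) = tamari_interval s U (tree_plus s U B)"
  shows "T = U" "A = B"
proof -
  have *: "T = U" "tree_plus s T A = tree_plus s U B"
    using tamari_interval_eqD[OF T(1) tree_plus_tamari[OF T] weak_le_tree_plus[OF T]
      U(1) tree_plus_tamari[OF U] weak_le_tree_plus[OF U] eq] by blast+
  then show "T = U"
    by blast
  show "A = B"
    using ascents_from_tree_plus[OF T] ascents_from_tree_plus[OF U] * by simp
qed

lemma face_dim_eq:
  assumes "T \<in> tamari_trees s" "A \<subseteq> tamari_ascents s T"
  shows "face_dim s (tamari_interval s T (tree_plus s T A)) = card A"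
  unfolding face_dim_def
proof (rule the_equality)
  show "\<exists>T' A'. T' \<in> tamari_trees s \<and> A' \<subseteq> tamari_ascents s T' \<and>
      tamari_interval s T (tree_plus s T A) = tamari_interval s T' (tree_plus s T' A') \<and>
      card A = card A'"
    using assms by blast
qed (use face_eqD[OF assms] in blast)

lemma sum_monom_card_Pow:
  assumes "finite A"
  shows "(\<Sum>B\<in>Pow A. monom 1 (card B)) = ([:1, 1:] :: int poly) ^ card A"
proof -
  have "(\<Prod>x\<in>A. monom 1 1 + 1) = (\<Sum>B\<in>Pow A. (\<Prod>x\<in>B. monom 1 1) * (\<Prod>x\<in>A - B. 1 :: int poly))"
    using assms by (rule prod_add)
  also have "\<dots> = (\<Sum>B\<in>Pow A. monom 1 (card B))"
    by (simp add: monom_power)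
  finally show ?thesis
    by (simp add: monom_Suc one_pCons)
qed

theorem proposition2p4:
  fixes s :: weak_comp
  shows "f_polynomial s = (\<Sum>T\<in>tamari_trees s. [:1, 1:] ^ tasc s T)"
proof -
  let ?P = "Sigma (tamari_trees s) (\<lambda>T. Pow (tamari_ascents s T))"
  let ?F = "\<lambda>(T, A). tamari_interval s T (tree_plus s T A)"
  have inj: "inj_on ?F ?P"
    by (rule inj_onI) (auto dest: face_eqD)
  have "Asso s = ?F ` ?P"
    unfolding Asso_def by force
  then have "f_polynomial s = (\<Sum>(T, A)\<in>?P. monom 1 (card A))"
    unfolding f_polynomial_def
    by (simp add: sum.reindex[OF inj]) (auto simp: face_dim_eq intro!: sum.cong)
  also have "\<dots> = (\<Sum>T\<in>tamari_trees s. \<Sum>A\<in>Pow (tamari_ascents s T). monom 1 (card A))"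
    using finite_tamari_trees finite_tamari_ascents by (intro sum.Sigma[symmetric]) auto
  also have "\<dots> = (\<Sum>T\<in>tamari_trees s. [:1, 1:] ^ tasc s T)"
    using sum_monom_card_Pow[OF finite_tamari_ascents] by (simp add: tasc_def)
  finally show ?thesis .
qed

end
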